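(* Let $A$ be a real $d\times d$ Hurwitz matrix and let $T>0$. Then $T>T_{cut}(A)$ if and only if the value of the convex extremal problem $$\max\bigl\{\,p(T)\ :\ p\in\mathcal{P}_A,\ \|p\|_{C(\mathbb{R}_+)}\le 1\,\bigr\}$$ is smaller than $1$.
   Context: A matrix is Hurwitz if all its eigenvalues have negative real parts. $\mathbb{R}_+=[0,+\infty)$ and $\|p\|_{C(\mathbb{R}_+)}=\sup_{t\ge 0}|p(t)|$. The space $\mathcal{P}_A$ is the real linear space of scalar functions of $t$ spanned by the entries of $e^{tA}$; equivalently, it is the span of the quasipolynomials $t^k e^{\alpha t}\cos\beta t$ and $t^k e^{\alpha t}\sin\beta t$, where $\alpha+i\beta$ runs over the eigenvalues of $A$, $k=0,\ldots,r-1$, and $r$ is the size of the largest Jordan block of $A$ corresponding to that eigenvalue. Its dimension equals the degree of the minimal polynomial of $A$. The number $T_{cut}(A)$. Let $x_0\in\mathbb{R}^d$ be a generic point, i.e. one that does not belong to any proper invariant subspace of $A$. Put $x(t)=e^{tA}x_0$ and, for $M\subset\mathbb{R}^d$, ${\rm co}_s M={\rm co}(M\cup(-M))$ (symmetrized convex hull). Let $G(t_1,t_2)={\rm co}_s\{x(t): t\in[t_1,t_2]\}$. A number $T\ge 0$ is a cut tail point of $A$ if for every $t>T$ the point $x(t)$ belongs to the interior of $G(0,T)$. The set of cut tail points does not depend on the choice of generic $x_0$, and $T_{cut}(A)$ is its minimal element. If $A$ has no generic point (its minimal polynomial has degree less than $d$), one takes $x_0$ such that the smallest $A$-invariant subspace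 $L$ containing $x_0$ has dimension equal to the degree of the minimal polynomial of $A$, and applies the definition to the restriction of $A$ to $L$ (interiors being taken in $L$). *)

theory Defs
  imports "HOL-Analysis.Analysis" "HOL-Computational_Algebra.Polynomial"
begin

definition complex_eigenvalue :: "real^'n^'n \<Rightarrow> complex \<Rightarrow> bool" where
  "complex_eigenvalue A z \<longleftrightarrow>
     (\<exists>v::complex^'n. v \<noteq> 0 \<and> map_matrix complex_of_real A *v v = z *s v)"

definition hurwitz :: "real^'n^'n \<Rightarrow> bool" where
  "hurwitz A \<longleftrightarrow> (\<forall>z. complex_eigenvalue A z \<longrightarrow> Re z < 0)"

(* The class operations (^) and exp cannot be used on matrices: multiplication of type
   vec is componentwise. *)

definition mat_power :: "real^'n^'n \<Rightarrow> nat \<Rightarrow> real^'n^'n" where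
  "mat_power A k = (((**) A) ^^ k) (mat 1)"

definition mat_exp :: "real^'n^'n \<Rightarrow> real^'n^'n" where
  "mat_exp A = (\<Sum>k. (1 / fact k) *\<^sub>R mat_power A k)"

definition poly_mat :: "real poly \<Rightarrow> real^'n^'n \<Rightarrow> real^'n^'n" where
  "poly_mat p A = (\<Sum>k\<le>degree p. coeff p k *\<^sub>R mat_power A k)"

definition min_poly :: "real^'n^'n \<Rightarrow> real poly" where
  "min_poly A = (THE p. lead_coeff p = 1 \<and> poly_mat p A = 0 \<and>
     (\<forall>q. q \<noteq> 0 \<and> poly_mat q A = 0 \<longrightarrow> degree p \<le> degree q))"

definition quasipoly_space :: "real^'n^'n \<Rightarrow> (real \<Rightarrow> real) set" where
  "quasipoly_space A =
     {p. \<exists>c::real^'n^'n. \<forall>t. p t =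
        (\<Sum>i\<in>UNIV. \<Sum>j\<in>UNIV. c $ i $ j * mat_exp (t *\<^sub>R A) $ i $ j)}"

(* Valued in ereal, so that an unbounded function has norm infinity. *)
definition half_line_norm :: "(real \<Rightarrow> real) \<Rightarrow> ereal" where
  "half_line_norm p = (SUP t\<in>{0..}. ereal \<bar>p t\<bar>)"

definition extremal_value :: "real^'n^'n \<Rightarrow> real \<Rightarrow> real" where
  "extremal_value A T =
     (GREATEST v. \<exists>p\<in>quasipoly_space A. half_line_norm p \<le> 1 \<and> v = p T)"

definition invariant_subspace :: "real^'n^'n \<Rightarrow> (real^'n) set \<Rightarrow> bool" where
  "invariant_subspace A S \<longleftrightarrow> subspace S \<and> (\<forall>x\<in>S. A *v x \<in> S)"

definition generic_point :: "real^'n^'n \<Rightarrow> real^'n \<Rightarrow> bool" where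
  "generic_point A x0 \<longleftrightarrow> (\<forall>S. invariant_subspace A S \<and> S \<noteq> UNIV \<longrightarrow> x0 \<notin> S)"

definition trajectory :: "real^'n^'n \<Rightarrow> real^'n \<Rightarrow> real \<Rightarrow> real^'n" where
  "trajectory A x0 t = mat_exp (t *\<^sub>R A) *v x0"

definition sym_convex_hull :: "(real^'n) set \<Rightarrow> (real^'n) set" where
  "sym_convex_hull M = convex hull (M \<union> uminus ` M)"

definition traj_hull :: "real^'n^'n \<Rightarrow> real^'n \<Rightarrow> real \<Rightarrow> real \<Rightarrow> (real^'n) set" where
  "traj_hull A x0 t1 t2 = sym_convex_hull (trajectory A x0 ` {t1..t2})"

(* The set of such T is the same for all admissible initial points, so quantifying
   x0 existentially is just a way of fixing one. In the second case (no generic point) L is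
   the smallest A-invariant subspace containing x0; the trajectory stays in L, and interiors
   are relative to L. *)
definition cut_tail_point :: "real^'n^'n \<Rightarrow> real \<Rightarrow> bool" where
  "cut_tail_point A T \<longleftrightarrow> 0 \<le> T \<and>
     (if \<exists>x0. generic_point A x0
      then \<exists>x0. generic_point A x0 \<and>
             (\<forall>t>T. trajectory A x0 t \<in> interior (traj_hull A x0 0 T))
      else \<exists>x0 L. L = invariant_subspace A hull {x0} \<and> dim L = degree (min_poly A) \<and>
             (\<forall>t>T. trajectory A x0 t \<in>
                top_of_set L interior_of traj_hull A x0 0 T))"

definition T_cut :: "real^'n^'n \<Rightarrow> real" where
  "T_cut A = (LEAST T. cut_tail_point A T)"

end

theory Submission
  imports Defs "HOL-Computational_Algebra.Polynomial_Factorial"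
    "HOL-Computational_Algebra.Field_as_Ring"
    "HOL-Computational_Algebra.Fundamental_Theorem_Algebra" "HOL-Real_Asymp.Real_Asymp"
begin

text \<open>
  Let \<open>x\<close> be the trajectory of an admissible point and \<open>L\<close> the invariant subspace it generates.
  The functions in \<open>P\<^sub>A\<close> are exactly \<open>t \<mapsto> y \<bullet> x t\<close>, so the extremal value is the maximum of
  \<open>y \<bullet> x T\<close> over the polar set of the trajectory, and it is smaller than 1 iff \<open>x T\<close> lies in the
  interior, relative to \<open>L\<close>, of the symmetrized hull \<open>G\<close> of the entire trajectory. The times with
  this property form an open ray \<open>T0 < t\<close>: the polar set is mapped into itself by the transposed
  semigroup. Since \<open>A\<close> is Hurwitz, \<open>x t\<close> tends to \<open>0\<close> and \<open>G\<close> is compact; its extreme points are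
  among \<open>\<plusminus> x t\<close> with \<open>t \<le> T0\<close>, so by Krein-Milman \<open>G = G(0, T0)\<close> and \<open>T0\<close> is the least cut tail
  point. As the extremal value does not mention the initial point, neither does \<open>T0\<close>.
\<close>

section \<open>Matrix exponential\<close>

lemma matrix_add_right_distrib:
  "((B :: real^'n^'m) + C) ** (A :: real^'p^'n) = B ** A + C ** A"
  by (simp add: vec_eq_iff matrix_matrix_mult_def sum.distrib distrib_right)

lemma bounded_bilinear_matrix_matrix_mult:
  "bounded_bilinear ((**) :: real^'n^'m \<Rightarrow> real^'p^'n \<Rightarrow> real^'p^'m)"
  unfolding bilinear_conv_bounded_bilinear[symmetric] bilinear_def
  by (auto intro!: linearI simp: matrix_add_ldistrib matrix_add_right_distrib matrix_scalar_ac
      scalar_matrix_assoc)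

lemma bounded_bilinear_matrix_vector_mult:
  "bounded_bilinear ((*v) :: real^'n^'m \<Rightarrow> real^'n \<Rightarrow> real^'m)"
  unfolding bilinear_conv_bounded_bilinear[symmetric] bilinear_def
  by (auto intro!: linearI simp: matrix_vector_right_distrib matrix_vector_mult_add_rdistrib
      matrix_vector_mult_scaleR scaleR_matrix_vector_assoc)

interpretation mm: bounded_bilinear "(**) :: real^'n^'m \<Rightarrow> real^'p^'n \<Rightarrow> real^'p^'m"
  by (rule bounded_bilinear_matrix_matrix_mult)

interpretation mv: bounded_bilinear "(*v) :: real^'n^'m \<Rightarrow> real^'n \<Rightarrow> real^'m"
  by (rule bounded_bilinear_matrix_vector_mult)

lemma mat_power_0: "mat_power A 0 = mat 1"
  by (simp add: mat_power_def)

lemma mat_power_Suc: "mat_power A (Suc k) = A ** mat_power A k"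
  by (simp add: mat_power_def)

lemma mat_power_scaleR: "mat_power (t *\<^sub>R A) k = t ^ k *\<^sub>R mat_power A k"
  by (induction k) (simp_all add: mat_power_0 mat_power_Suc mm.scaleR_left mm.scaleR_right)

text \<open>Termwise differentiation is reduced to scalar power series by taking the coordinate
  along each basis vector \<open>b\<close>.\<close>

lemma has_vector_derivative_power_series:
  fixes c :: "nat \<Rightarrow> 'a::euclidean_space"
  assumes "\<And>t. summable (\<lambda>k. t ^ k *\<^sub>R c k)"
    and "\<And>t. summable (\<lambda>k. t ^ k *\<^sub>R (real (Suc k) *\<^sub>R c (Suc k)))"
  shows "((\<lambda>t. \<Sum>k. t ^ k *\<^sub>R c k) has_vector_derivative
    (\<Sum>k. t ^ k *\<^sub>R (real (Suc k) *\<^sub>R c (Suc k)))) (at t)"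
  unfolding has_vector_derivative_def
proof (subst has_derivative_componentwise_within, intro ballI)
  fix b :: 'a assume "b \<in> Basis"
  have sm: "summable (\<lambda>k. (c k \<bullet> b) * t ^ k)" for t
    using bounded_linear.summable[OF bounded_linear_inner_left assms(1)[of t], of b]
    by (simp add: mult.commute)
  have "((\<lambda>t. \<Sum>k. (c k \<bullet> b) * t ^ k) has_field_derivative
      (\<Sum>k. diffs (\<lambda>k. c k \<bullet> b) k * t ^ k)) (at t)"
    by (rule termdiffs_strong_converges_everywhere[OF sm])
  moreover have "(\<Sum>k. t ^ k *\<^sub>R c k) \<bullet> b = (\<Sum>k. (c k \<bullet> b) * t ^ k)" for t
    using bounded_linear.suminf[OF bounded_linear_inner_left assms(1)[of t], of b]
    by (simp add: mult.commute)
  moreover have "(\<Sum>k. t ^ k *\<^sub>R (real (Suc k) *\<^sub>R c (Suc k))) \<bullet> b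
      = (\<Sum>k. diffs (\<lambda>k. c k \<bullet> b) k * t ^ k)"
    unfolding bounded_linear.suminf[OF bounded_linear_inner_left assms(2)[of t], of b]
    by (rule suminf_cong) (simp add: diffs_def)
  ultimately show "((\<lambda>t. (\<Sum>k. t ^ k *\<^sub>R c k) \<bullet> b) has_derivative
      (\<lambda>x. (x *\<^sub>R (\<Sum>k. t ^ k *\<^sub>R (real (Suc k) *\<^sub>R c (Suc k)))) \<bullet> b)) (at t)"
    by (simp add: has_field_derivative_def fun_eq_iff mult.commute mult_commute_abs)
qed

lemma summable_mat_exp: "summable (\<lambda>k. (1 / fact k) *\<^sub>R mat_power (A :: real^'n^'n) k)"
proof -
  \<comment> \<open>The norm on matrices is the Euclidean one; the constant \<open>K\<close> of the
    bounded bilinear product stands in for submultiplicativity.\<close>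
  obtain K where K: "K > 0" "\<And>(A::real^'n^'n) (B::real^'n^'n). norm (A ** B) \<le> norm A * norm B * K"
    using mm.pos_bounded by blast
  let ?I = "mat 1 :: real^'n^'n"
  have "norm (mat_power A k) \<le> (norm A * K) ^ k * norm ?I" for k
  proof (induction k)
    case (Suc k)
    have "norm (mat_power A (Suc k)) \<le> norm A * norm (mat_power A k) * K"
      by (simp add: mat_power_Suc K)
    also have "\<dots> \<le> norm A * ((norm A * K) ^ k * norm ?I) * K"
      using Suc K(1) by (intro mult_right_mono mult_left_mono) auto
    finally show ?case by (simp add: mult_ac)
  qed (simp add: mat_power_0)
  then have "norm ((1 / fact k) *\<^sub>R mat_power A k)
      \<le> (inverse (fact k) * (norm A * K) ^ k) * norm ?I" for k
    by (simp add: divide_simps)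
  then show ?thesis
    by (intro summable_comparison_test'[OF summable_mult2[OF summable_exp]]) auto
qed

lemma mat_exp_power_series:
  "mat_exp (t *\<^sub>R A) = (\<Sum>k. t ^ k *\<^sub>R ((1 / fact k) *\<^sub>R mat_power A k))"
  by (simp add: mat_exp_def mat_power_scaleR)

lemma summable_mat_exp_power_series:
  "summable (\<lambda>k. t ^ k *\<^sub>R ((1 / fact k) *\<^sub>R mat_power A k))"
  using summable_mat_exp[of "t *\<^sub>R A"] by (simp add: mat_power_scaleR)

lemma mat_exp_has_vector_derivative:
  "((\<lambda>t. mat_exp (t *\<^sub>R A)) has_vector_derivative A ** mat_exp (t *\<^sub>R A)) (at t)"
proof -
  define c where "c k = (1 / fact k) *\<^sub>R mat_power A k" for k
  \<comment> \<open>The factor \<open>Suc k\<close> cancels against the factorial, so the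
    differentiated series is \<open>A\<close> times the original one.\<close>
  have c: "t ^ k *\<^sub>R (real (Suc k) *\<^sub>R c (Suc k)) = A ** (t ^ k *\<^sub>R c k)" for t k
    by (simp add: c_def mat_power_Suc mm.scaleR_right field_simps del: of_nat_Suc)
  have s: "summable (\<lambda>k. t ^ k *\<^sub>R c k)" for t
    unfolding c_def by (rule summable_mat_exp_power_series)
  have "((\<lambda>t. \<Sum>k. t ^ k *\<^sub>R c k) has_vector_derivative
      (\<Sum>k. t ^ k *\<^sub>R (real (Suc k) *\<^sub>R c (Suc k)))) (at t)"
    by (rule has_vector_derivative_power_series[OF s])
      (simp only: c bounded_linear.summable[OF mm.bounded_linear_right s])
  moreover have "(\<Sum>k. t ^ k *\<^sub>R (real (Suc k) *\<^sub>R c (Suc k))) = A ** (\<Sum>k. t ^ k *\<^sub>R c k)"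
    by (simp only: c bounded_linear.suminf[OF mm.bounded_linear_right s])
  ultimately show ?thesis
    by (simp add: mat_exp_power_series c_def)
qed

lemma mat_exp_0: "mat_exp (0 *\<^sub>R A) = mat 1"
  using mat_exp_power_series[of 0 A] powser_zero
  by (subst mat_exp_power_series, subst suminf_finite[of "{0}"]) (auto simp: mat_power_0)

section \<open>The algebra of polynomials in a matrix\<close>

definition matrix_algebra :: "real^'n^'n \<Rightarrow> (real^'n^'n) set" where
  "matrix_algebra A = span (range (mat_power A))"

lemma subspace_matrix_algebra: "subspace (matrix_algebra A)"
  by (simp add: matrix_algebra_def)

lemma mat_power_in_matrix_algebra: "mat_power A k \<in> matrix_algebra A"
  by (simp add: matrix_algebra_def span_base)

lemma mat_1_in_matrix_algebra: "mat 1 \<in> matrix_algebra A"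
  by (metis mat_power_0 mat_power_in_matrix_algebra)

lemma mult_in_matrix_algebra:
  assumes "M \<in> matrix_algebra A" shows "A ** M \<in> matrix_algebra A"
  using assms unfolding matrix_algebra_def
proof (induction rule: span_induct_alt)
  case base
  then show ?case by (simp add: span_0)
next
  case (step c x y)
  then show ?case
    by (auto simp: mm.add_right mm.scaleR_right mat_power_Suc[symmetric]
        intro!: span_add_eq2[THEN iffD2] span_scale[OF span_base])
qed

lemma matrix_algebra_commute:
  assumes "M \<in> matrix_algebra A" shows "M ** A = A ** M"
proof -
  have pow: "mat_power A k ** A = A ** mat_power A k" for k
    by (induction k) (simp_all add: mat_power_0 mat_power_Suc flip: matrix_mul_assoc)
  show ?thesis
    using assms unfolding matrix_algebra_def
    by (induction rule: span_induct_alt)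
      (auto simp: pow mm.add_left mm.add_right mm.scaleR_left mm.scaleR_right)
qed

text \<open>The partial sums are polynomials in \<open>A\<close>, and a subspace of a
  finite-dimensional space is closed, so the limit stays inside.\<close>

lemma mat_exp_in_matrix_algebra: "mat_exp (t *\<^sub>R A) \<in> matrix_algebra A"
proof (rule closed_sequentially[OF closed_subspace[OF subspace_matrix_algebra]])
  show "(\<lambda>n. \<Sum>k<n. t ^ k *\<^sub>R ((1 / fact k) *\<^sub>R mat_power A k)) \<longlonglongrightarrow> mat_exp (t *\<^sub>R A)"
    unfolding mat_exp_power_series
    by (rule summable_LIMSEQ[OF summable_mat_exp_power_series])
next
  show "(\<Sum>k<n. t ^ k *\<^sub>R ((1 / fact k) *\<^sub>R mat_power A k)) \<in> matrix_algebra A" for n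
    unfolding matrix_algebra_def by (intro span_sum span_scale span_base rangeI)
qed

text \<open>The product \<open>?E (- t) ** ?E (s + t)\<close> has zero derivative in
  \<open>t\<close> because \<open>A\<close> commutes with its exponential. It therefore equals its
  value \<open>?E s\<close> at \<open>t = 0\<close>; the case \<open>s = 0\<close> yields
  inverses.\<close>

lemma mat_exp_add: "mat_exp ((s + t) *\<^sub>R A) = mat_exp (s *\<^sub>R A) ** mat_exp (t *\<^sub>R A)"
proof -
  let ?E = "\<lambda>t. mat_exp (t *\<^sub>R A)"
  have comm: "?E t ** A = A ** ?E t" for t
    by (rule matrix_algebra_commute[OF mat_exp_in_matrix_algebra])
  have const_ex: "\<exists>C. \<forall>t. ?E (- t) ** ?E (s + t) = C" for s
  proof -
    have 1: "((\<lambda>t. ?E (- t)) has_vector_derivative - (A ** ?E (- t))) (at t)" for t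
      using vector_diff_chain_at[of "\<lambda>t. - t" "-1" t ?E "A ** ?E (- t)"]
        mat_exp_has_vector_derivative[of A "- t"]
      by (simp add: o_def has_vector_derivative_minus[OF has_vector_derivative_id])
    have has_vector_derivative_shift: "((+) s has_vector_derivative 1) (at t)" for t
      by (auto intro!: derivative_eq_intros)
    have 2: "((\<lambda>t. ?E (s + t)) has_vector_derivative A ** ?E (s + t)) (at t)" for t
      using vector_diff_chain_at[of "\<lambda>t. s + t" 1 t ?E "A ** ?E (s + t)"]
        mat_exp_has_vector_derivative[of A "s + t"]
      by (simp add: o_def has_vector_derivative_shift)
    have "((\<lambda>t. ?E (- t) ** ?E (s + t)) has_vector_derivative 0) (at t)" for t
      using mm.has_vector_derivative[OF 1 2, of t]
      by (simp add: mm.minus_left matrix_mul_assoc comm[of "- t", simplified])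
    then show ?thesis
      using has_vector_derivative_zero_constant[of UNIV "\<lambda>t. ?E (- t) ** ?E (s + t)"]
      by (metis UNIV_I convex_UNIV)
  qed
  have const: "?E (- t) ** ?E (s + t) = ?E s" for s t
  proof -
    obtain C where C: "\<And>t. ?E (- t) ** ?E (s + t) = C"
      using const_ex[of s] by blast
    show ?thesis
      using C[of t] C[of 0] by (simp add: mat_exp_0[simplified])
  qed
  have inv: "?E t ** ?E (- t) = mat 1" for t
    using const[of "- t" 0] by (simp add: mat_exp_0[simplified])
  have "?E (t + s) = ?E s ** (?E (- s) ** ?E (t + s))"
    by (simp only: matrix_mul_assoc inv matrix_mul_lid)
  then show ?thesis
    by (simp only: const add.commute[of s t])
qed

section \<open>Minimal polynomial\<close>

lemma poly_mat_eq_sum: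
  assumes "degree p \<le> N"
  shows "poly_mat p A = (\<Sum>k\<le>N. coeff p k *\<^sub>R mat_power A k)"
  unfolding poly_mat_def using assms
  by (intro sum.mono_neutral_left) (auto simp: coeff_eq_0)

lemma poly_mat_0 [simp]: "poly_mat 0 A = 0"
  by (simp add: poly_mat_def)

lemma poly_mat_monom: "poly_mat (monom c k) A = c *\<^sub>R mat_power A k"
  by (subst poly_mat_eq_sum[where N = k])
    (auto simp: degree_monom_le if_distrib[of "\<lambda>x. x *\<^sub>R _"] cong: if_cong)

lemma poly_mat_add: "poly_mat (p + q) A = poly_mat p A + poly_mat q A"
proof -
  let ?N = "max (degree p) (degree q)"
  have "degree (p + q) \<le> ?N" by (rule degree_add_le_max)
  then show ?thesis
    by (simp add: poly_mat_eq_sum[where N = ?N] scaleR_add_left sum.distrib)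
qed

lemma poly_mat_smult: "poly_mat (smult c p) A = c *\<^sub>R poly_mat p A"
  by (simp add: poly_mat_eq_sum[OF degree_smult_le] poly_mat_def scaleR_sum_right)

lemma poly_mat_diff: "poly_mat (p - q) A = poly_mat p A - poly_mat q A"
  using poly_mat_add[of p "- q" A] poly_mat_smult[of "- 1" q A] by simp

lemma poly_mat_pCons: "poly_mat (pCons a p) A = a *\<^sub>R mat 1 + A ** poly_mat p A"
proof -
  have "poly_mat (pCons a p) A = (\<Sum>k\<le>Suc (degree p). coeff (pCons a p) k *\<^sub>R mat_power A k)"
    by (rule poly_mat_eq_sum) (simp add: degree_pCons_le)
  also have "\<dots> = a *\<^sub>R mat 1 + A ** poly_mat p A"
    by (simp add: sum.atMost_Suc_shift poly_mat_def mat_power_0 mat_power_Suc mm.sum_right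
        mm.scaleR_right del: sum.atMost_Suc)
  finally show ?thesis .
qed

lemma poly_mat_mult: "poly_mat (p * q) A = poly_mat p A ** poly_mat q A"
proof (induction p)
  case (pCons a p)
  then show ?case
    by (simp add: poly_mat_add poly_mat_smult poly_mat_pCons mm.add_left mm.scaleR_left
        matrix_mul_assoc)
qed simp

text \<open>The bound concerns the coefficients rather than the degree, so that it forces
  \<open>p = 0\<close> when \<open>k = 0\<close>.\<close>

lemma span_mat_power_lessThan:
  assumes "M \<in> span (mat_power A ` {..<k})"
  obtains p where "M = poly_mat p A" "\<And>i. i \<ge> k \<Longrightarrow> coeff p i = 0"
proof -
  have "\<exists>p. M = poly_mat p A \<and> (\<forall>i\<ge>k. coeff p i = 0)"
    using assms
  proof (induction rule: span_induct_alt)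
    case base
    show ?case by (rule exI[of _ 0]) simp
  next
    case (step c x y)
    then obtain p i where "y = poly_mat p A" "\<forall>i\<ge>k. coeff p i = 0" "x = mat_power A i" "i < k"
      by auto
    then show ?case
      by (intro exI[of _ "monom c i + p"]) (auto simp: poly_mat_add poly_mat_monom)
  qed
  then show ?thesis using that by blast
qed

lemma matrix_algebra_poly_mat:
  assumes "M \<in> matrix_algebra A"
  obtains p where "M = poly_mat p A"
proof -
  have "\<exists>p. M = poly_mat p A"
    using assms unfolding matrix_algebra_def
  proof (induction rule: span_induct_alt)
    case base
    show ?case by (rule exI[of _ 0]) simp
  next
    case (step c x y)
    then obtain p i where "y = poly_mat p A" "x = mat_power A i"
      by auto
    then show ?case
      by (intro exI[of _ "monom c i + p"]) (auto simp: poly_mat_add poly_mat_monom)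
  qed
  then show ?thesis using that by blast
qed

text \<open>Let \<open>m\<close> be the first exponent whose power depends linearly on the earlier
  ones. The powers below \<open>m\<close> form a basis of the algebra, and the dependency itself is
  a monic annihilating polynomial of degree \<open>m\<close>, so degree and dimension come out
  together.\<close>

lemma ex_min_poly:
  fixes A :: "real^'n^'n"
  shows "\<exists>p. lead_coeff p = 1 \<and> poly_mat p A = 0 \<and>
    (\<forall>q. q \<noteq> 0 \<and> poly_mat q A = 0 \<longrightarrow> degree p \<le> degree q) \<and> degree p = dim (matrix_algebra A)"
proof -
  define dep where "dep k \<longleftrightarrow> mat_power A k \<in> span (mat_power A ` {..<k})" for k
  have indep: "independent (mat_power A ` {..<k}) \<and> card (mat_power A ` {..<k}) = k"
    if "\<And>i. i < k \<Longrightarrow> \<not> dep i" for k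
    using that
  proof (induction k)
    case (Suc k)
    have "\<not> dep k"
      using Suc.prems by blast
    moreover have "independent (mat_power A ` {..<k})" "card (mat_power A ` {..<k}) = k"
      using Suc.IH[OF Suc.prems[OF less_SucI]] by simp_all
    moreover from \<open>\<not> dep k\<close> have "mat_power A k \<notin> mat_power A ` {..<k}"
      using span_base dep_def by metis
    ultimately show ?case
      using independent_insertI[of "mat_power A k" "mat_power A ` {..<k}"]
      by (simp add: lessThan_Suc dep_def)
  qed (simp add: independent_empty)
  have "\<exists>k. dep k"
  proof (rule ccontr)
    assume "\<nexists>k. dep k"
    then have "independent (mat_power A ` {..<Suc N}) \<and> card (mat_power A ` {..<Suc N}) = Suc N" for N
      using indep by blast
    then show False
      using independent_bound by (metis not_less_eq_eq order_refl)
  qed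
  define m where "m = (LEAST k. dep k)"
  have m: "dep m" "\<And>i. i < m \<Longrightarrow> \<not> dep i"
    using \<open>\<exists>k. dep k\<close> unfolding m_def by (auto intro: LeastI_ex dest: not_less_Least)
  let ?V = "span (mat_power A ` {..<m})"
  \<comment> \<open>Multiplication by \<open>A\<close> shifts exponents by one; only the shift from
    \<open>m - 1\<close> to \<open>m\<close> leaves the range, and there the dependency at
    \<open>m\<close> applies.\<close>
  have AV: "A ** M \<in> ?V" if "M \<in> ?V" for M
    using that
  proof (induction rule: span_induct_alt)
    case base
    then show ?case by (simp add: span_zero)
  next
    case (step c x y)
    then obtain i where i: "x = mat_power A i" "i < m" by auto
    have "mat_power A (Suc i) \<in> ?V"
      using i(2) m(1) by (cases "Suc i = m") (auto simp: dep_def intro!: span_base)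
    then show ?case
      using step by (simp add: i mm.add_right mm.scaleR_right mat_power_Suc span_add span_scale)
  qed
  have "mat_power A k \<in> ?V" for k
  proof (induction k)
    case 0
    show ?case using m(1) by (cases m) (auto simp: dep_def intro!: span_base)
  qed (simp add: mat_power_Suc AV)
  then have "matrix_algebra A = ?V"
    unfolding matrix_algebra_def by (intro span_eq[THEN iffD2]) (auto intro: span_base)
  then have dim: "dim (matrix_algebra A) = m"
    using indep[OF m(2)] by (simp add: dim_eq_card_independent)
  obtain p where p: "mat_power A m = poly_mat p A" "\<And>i. i \<ge> m \<Longrightarrow> coeff p i = 0"
    using m(1) span_mat_power_lessThan unfolding dep_def by metis
  let ?P = "monom 1 m - p"
  have "degree ?P \<le> m"
    by (rule degree_le) (auto simp: p)
  moreover have cm: "coeff ?P m = 1" by (simp add: p)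
  ultimately have deg: "degree ?P = m"
    using le_degree[of ?P m] by simp
  \<comment> \<open>Solving for the leading power of an annihilating \<open>q\<close> of degree
    below \<open>m\<close> would give a dependency earlier than the first one.\<close>
  have "m \<le> degree q" if q: "q \<noteq> 0" "poly_mat q A = 0" for q
  proof (rule ccontr)
    assume "\<not> m \<le> degree q"
    let ?d = "degree q"
    have "(\<Sum>k<?d. coeff q k *\<^sub>R mat_power A k) + lead_coeff q *\<^sub>R mat_power A ?d = 0"
      using q(2) unfolding poly_mat_def lessThan_Suc_atMost[symmetric] by simp
    then have "mat_power A ?d
        = (- 1 / lead_coeff q) *\<^sub>R (\<Sum>k<?d. coeff q k *\<^sub>R mat_power A k)"
      using q(1) by (simp add: eq_neg_iff_add_eq_0[symmetric])
    also have "\<dots> \<in> span (mat_power A ` {..<?d})"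
      by (intro span_scale span_sum span_base imageI) simp
    finally show False
      using m(2)[of ?d] \<open>\<not> m \<le> degree q\<close> unfolding dep_def by simp
  qed
  then show ?thesis
    using deg cm p(1) dim
    by (intro exI[of _ ?P]) (auto simp: poly_mat_diff poly_mat_monom)
qed

text \<open>The difference of two candidates annihilates \<open>A\<close> and has smaller degree
  since the leading terms cancel; so the definite description in \<open>min_poly\<close> denotes the
  polynomial found above.\<close>

lemma
  shows lead_coeff_min_poly: "lead_coeff (min_poly A) = 1"
    and poly_mat_min_poly: "poly_mat (min_poly A) A = 0"
    and degree_min_poly_le: "q \<noteq> 0 \<Longrightarrow> poly_mat q A = 0 \<Longrightarrow> degree (min_poly A) \<le> degree q"
    and degree_min_poly: "degree (min_poly A) = dim (matrix_algebra A)"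
proof -
  let ?P = "\<lambda>p. lead_coeff p = 1 \<and> poly_mat p A = 0 \<and>
    (\<forall>q. q \<noteq> 0 \<and> poly_mat q A = 0 \<longrightarrow> degree p \<le> degree q)"
  obtain p where p: "?P p" "degree p = dim (matrix_algebra A)"
    using ex_min_poly[of A] by blast
  have unique: "q = p" if q: "?P q" for q
  proof (rule ccontr)
    assume "q \<noteq> p"
    have nz: "p \<noteq> 0" "q \<noteq> 0" using p q by auto
    then have deg: "degree q = degree p" using p(1) q by (meson antisym)
    have "degree (q - p) < degree p"
    proof (rule degree_less_if_less_eqI)
      show "degree (q - p) \<le> degree p" using degree_diff_le_max[of q p] deg by simp
      show "coeff (q - p) (degree p) = 0" using deg p(1) q by simp
      show "q - p \<noteq> 0" using \<open>q \<noteq> p\<close> by simp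
    qed
    moreover have "poly_mat (q - p) A = 0" using p(1) q by (simp add: poly_mat_diff)
    ultimately show False using p(1) \<open>q \<noteq> p\<close> by (meson leD right_minus_eq)
  qed
  have "min_poly A = p"
    unfolding min_poly_def by (rule the_equality[where P = ?P, OF p(1) unique])
  with p show "lead_coeff (min_poly A) = 1" "poly_mat (min_poly A) A = 0"
    "q \<noteq> 0 \<Longrightarrow> poly_mat q A = 0 \<Longrightarrow> degree (min_poly A) \<le> degree q"
    "degree (min_poly A) = dim (matrix_algebra A)"
    by simp_all
qed

lemma min_poly_nonzero: "min_poly A \<noteq> 0"
  using lead_coeff_min_poly[of A] by auto

text \<open>
  If \<open>q(A) x = 0\<close> but \<open>q(A) \<noteq> 0\<close>, then the gcd of \<open>q\<close> and the minimal polynomial \<open>m\<close> is a proper divisor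
  of \<open>m\<close>, hence divides \<open>m / \<pi>\<close> for some prime \<open>\<pi>\<close>. So it suffices to avoid the kernels of the finitely
  many nonzero matrices \<open>(m / \<pi>)(A)\<close>, which are null sets.
\<close>

lemma ex_faithful_vector:
  fixes A :: "real^'n^'n"
  obtains x where "\<And>M. M \<in> matrix_algebra A \<Longrightarrow> M *v x = 0 \<Longrightarrow> M = 0"
proof -
  let ?m = "min_poly A"
  let ?K = "\<lambda>\<pi>. {x. poly_mat (?m div \<pi>) A *v x = 0}"
  have negl: "negligible (?K \<pi>)" if "\<pi> \<in> prime_factors ?m" for \<pi>
  proof (rule negligible_lowdim, rule ccontr)
    assume "\<not> dim (?K \<pi>) < DIM(real^'n)"
    moreover have sub: "subspace (?K \<pi>)"
      by (auto simp: subspace_def mv.add_right mv.scaleR_right)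
    ultimately have "?K \<pi> = UNIV"
      by (metis (no_types, lifting) dim_eq_full linorder_not_le dim_subset_UNIV le_antisym span_eq_iff)
    then have "poly_mat (?m div \<pi>) A = 0"
      by (metis (mono_tags, lifting) UNIV_I mem_Collect_eq matrix_eq mv.zero_left)
    moreover have pr: "\<pi> dvd ?m" "prime \<pi>"
      using that by auto
    moreover have nz: "?m div \<pi> \<noteq> 0"
      using pr(1) min_poly_nonzero[of A] by (simp add: dvd_div_eq_0_iff)
    ultimately have "degree ?m \<le> degree (?m div \<pi>)"
      by (simp add: degree_min_poly_le)
    moreover have "degree ?m = degree (?m div \<pi>) + degree \<pi>"
      using pr nz by (metis degree_mult_eq dvd_div_mult_self not_prime_0)
    moreover have "degree \<pi> \<noteq> 0"
      using pr(2) by (metis is_unit_iff_degree not_prime_0 not_prime_unit)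
    ultimately show False by simp
  qed
  have "negligible (\<Union>\<pi>\<in>prime_factors ?m. ?K \<pi>)"
    by (intro negligible_Union finite_imageI finite_set_mset) (auto simp: negl)
  then have "(\<Union>\<pi>\<in>prime_factors ?m. ?K \<pi>) \<noteq> UNIV"
    using non_negligible_UNIV by metis
  then obtain x where x: "\<And>\<pi>. \<pi> \<in> prime_factors ?m \<Longrightarrow> poly_mat (?m div \<pi>) A *v x \<noteq> 0"
    by auto
  show ?thesis
  proof
    fix M assume M: "M \<in> matrix_algebra A" "M *v x = 0"
    obtain q where q: "M = poly_mat q A"
      using M(1) by (rule matrix_algebra_poly_mat)
    define d where "d = gcd q ?m"
    \<comment> \<open>Bezout: as the minimal polynomial vanishes at \<open>A\<close>, the matrix
      \<open>poly_mat d A\<close> is a multiple of \<open>M\<close> and annihilates \<open>x\<close>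
      too.\<close>
    obtain a b where "a * q + b * ?m = d"
      using bezout_coefficients_fst_snd[of q ?m] unfolding d_def by metis
    then have "poly_mat d A = poly_mat a A ** M"
      by (auto simp: poly_mat_add poly_mat_mult poly_mat_min_poly q)
    then have dx: "poly_mat d A *v x = 0"
      using M(2) by (simp flip: matrix_vector_mul_assoc)
    obtain e where e: "?m = e * d"
      unfolding d_def by (metis dvd_def gcd_dvd2 mult.commute)
    have "is_unit e"
    proof (rule ccontr)
      assume "\<not> is_unit e"
      moreover have "e \<noteq> 0" using e min_poly_nonzero[of A] by auto
      ultimately obtain \<pi> where \<pi>: "\<pi> dvd e" "prime \<pi>"
        using prime_divisor_exists by blast
      then obtain f where f: "e = \<pi> * f" by blast
      have "\<pi> \<in> prime_factors ?m"
        using \<pi> e min_poly_nonzero[of A] by (simp add: in_prime_factors_iff)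
      moreover have "?m div \<pi> = f * d"
        using \<pi>(2) by (simp add: e f mult.assoc)
      ultimately show False
        using x[of \<pi>] dx by (simp add: poly_mat_mult flip: matrix_vector_mul_assoc)
    qed
    then have "?m dvd d" using e by simp
    then have "?m dvd q" unfolding d_def by simp
    then obtain c where "q = c * ?m" by (metis dvd_def mult.commute)
    then show "M = 0"
      by (simp add: q poly_mat_mult poly_mat_min_poly)
  qed
qed

section \<open>Decay of trajectories\<close>

text \<open>Variation of constants: \<open>f t\<close>, the product of \<open>v t\<close> with the
  factor \<open>exp (- l t)\<close>, has a derivative involving only \<open>u\<close>. Integrating
  it from a time after which \<open>u\<close> is small bounds \<open>v\<close> by a decaying
  exponential plus \<open>e / 2\<close>.\<close>

lemma complex_linear_ode_decay:
  fixes v u :: "real \<Rightarrow> complex"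
  assumes deriv: "\<And>t. (v has_vector_derivative l * v t + u t) (at t)"
    and l: "Re l < 0" and u: "(u \<longlongrightarrow> 0) at_top"
  shows "(v \<longlongrightarrow> 0) at_top"
proof (rule tendstoI)
  fix e :: real assume "e > 0"
  define a where "a = - Re l"
  have "a > 0" using l by (simp add: a_def)
  \<comment> \<open>The threshold \<open>a * (e / 2)\<close> for \<open>u\<close> is chosen so that
    \<open>exp (a * s) * (a * (e / 2))\<close> has the antiderivative
    \<open>exp (a * s) * (e / 2)\<close>.\<close>
  then have "a * (e / 2) > 0" using \<open>e > 0\<close> by simp
  then have "eventually (\<lambda>t. norm (u t) < a * (e / 2)) at_top"
    using tendstoD[OF u, of "a * (e / 2)"] by (simp only: dist_norm diff_zero)
  then obtain T where T: "\<And>t. t \<ge> T \<Longrightarrow> norm (u t) < a * (e / 2)"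
    by (auto simp: eventually_at_top_linorder)
  define f where "f t = exp (t *\<^sub>R (- l)) * v t" for t
  have df: "(f has_vector_derivative exp (t *\<^sub>R (- l)) * u t) (at t)" for t
  proof -
    have "((\<lambda>t. exp (t *\<^sub>R (- l))) has_vector_derivative exp (t *\<^sub>R (- l)) * (- l)) (at t)"
      by (rule exp_scaleR_has_vector_derivative_right)
    from has_vector_derivative_mult[OF this deriv[of t]] show ?thesis
      unfolding f_def by (simp add: algebra_simps)
  qed
  have nexp: "norm (exp (t *\<^sub>R (- l))) = exp (a * t)" for t :: real
    by (simp add: a_def mult.commute)
  have bound: "norm (v t) \<le> exp (- a * t) * norm (f T) + e / 2" if "t > T" for t
  proof -
    have "norm (f t - f T) \<le> exp (a * t) * (e / 2) - exp (a * T) * (e / 2)"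
    proof (rule differentiable_bound_general[OF that])
      show "continuous_on {T..t} f"
        using df by (meson continuous_at_imp_continuous_on has_vector_derivative_continuous)
      show "continuous_on {T..t} (\<lambda>x. exp (a * x) * (e / 2))"
        by (intro continuous_intros)
      show "((\<lambda>x. exp (a * x) * (e / 2)) has_vector_derivative exp (a * s) * (a * (e / 2))) (at s)" for s
        unfolding has_real_derivative_iff_has_vector_derivative[symmetric]
        by (auto intro!: derivative_eq_intros)
      show "norm (exp (s *\<^sub>R (- l)) * u s) \<le> exp (a * s) * (a * (e / 2))" if "T < s" for s
        unfolding norm_mult nexp using T[of s] that by (intro mult_left_mono) auto
    qed (rule df)
    then have "norm (f t) \<le> norm (f T) + exp (a * t) * (e / 2)"
      using norm_triangle_sub[of "f t" "f T"] exp_gt_zero[of "a * T"] \<open>e > 0\<close>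
      by (smt (verit) mult_pos_pos half_gt_zero)
    moreover have nf: "norm (f t) = exp (a * t) * norm (v t)"
      unfolding f_def norm_mult nexp ..
    ultimately have le: "exp (a * t) * norm (v t) \<le> norm (f T) + exp (a * t) * (e / 2)"
      by (simp only:)
    have "norm (v t) = exp (- a * t) * (exp (a * t) * norm (v t))"
      by (simp add: mult.assoc[symmetric] exp_add[symmetric])
    also have "\<dots> \<le> exp (- a * t) * (norm (f T) + exp (a * t) * (e / 2))"
      using le by (rule mult_left_mono) simp
    also have "\<dots> = exp (- a * t) * norm (f T) + e / 2"
      by (simp add: distrib_left mult.assoc[symmetric] exp_add[symmetric])
    finally show ?thesis .
  qed
  have "((\<lambda>t. exp (- a * t) * norm (f T)) \<longlongrightarrow> 0) at_top"
    using \<open>a > 0\<close> by real_asymp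
  then have "eventually (\<lambda>t. exp (- a * t) * norm (f T) < e / 2) at_top"
    using order_tendstoD(2)[of _ 0 at_top "e / 2"] half_gt_zero[OF \<open>e > 0\<close>] by blast
  with eventually_gt_at_top[of T] show "eventually (\<lambda>t. dist (v t) 0 < e) at_top"
  proof eventually_elim
    case (elim t)
    with bound[OF elim(1)] show ?case
      unfolding dist_norm diff_zero by linarith
  qed
qed

text \<open>This is \<open>q(B) v\<close>, built by iterating \<open>B\<close> on the vector, since
  \<open>mat_power\<close> is confined to real matrices.\<close>

definition cpoly_apply :: "complex poly \<Rightarrow> complex^'n^'n \<Rightarrow> complex^'n \<Rightarrow> complex^'n" where
  "cpoly_apply q B v = (\<Sum>k\<le>degree q. coeff q k *s ((*v) B ^^ k) v)"

lemma cpoly_apply_eq_sum: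
  assumes "degree q \<le> N"
  shows "cpoly_apply q B v = (\<Sum>k\<le>N. coeff q k *s ((*v) B ^^ k) v)"
  unfolding cpoly_apply_def using assms
  by (intro sum.mono_neutral_left) (auto simp: coeff_eq_0)

text \<open>Splits off one root: the coefficients of the product are those of \<open>r\<close>
  shifted by one minus \<open>l\<close> times those of \<open>r\<close>, and the two sums recombine
  to \<open>r\<close> applied to \<open>(B - l) v\<close>.\<close>

lemma cpoly_apply_linear_factor:
  "cpoly_apply ([:- l, 1:] * r) B v = cpoly_apply r B (B *v v - l *s v)"
proof -
  let ?N = "degree r"
  let ?p = "\<lambda>k. ((*v) B ^^ k) v"
  have pow: "((*v) B ^^ k) (B *v v - l *s v) = ?p (Suc k) - l *s ?p k" for k
    by (induction k) (auto simp: vec.diff vec.scale)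
  have coeff_mult: "coeff ([:- l, 1:] * r) k = coeff (pCons 0 r) k - l * coeff r k" for k
    by simp
  have "degree ([:- l, 1:] * r) \<le> Suc ?N"
    using degree_mult_le[of "[:- l, 1:]" r] by simp
  then have "cpoly_apply ([:- l, 1:] * r) B v = (\<Sum>k\<le>Suc ?N. coeff ([:- l, 1:] * r) k *s ?p k)"
    by (rule cpoly_apply_eq_sum)
  also have "\<dots> = (\<Sum>k\<le>Suc ?N. coeff (pCons 0 r) k *s ?p k) - (\<Sum>k\<le>Suc ?N. (l * coeff r k) *s ?p k)"
    unfolding coeff_mult vector_sub_rdistrib sum_subtractf ..
  also have "(\<Sum>k\<le>Suc ?N. coeff (pCons 0 r) k *s ?p k) = (\<Sum>k\<le>?N. coeff r k *s ?p (Suc k))"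
    by (simp add: sum.atMost_Suc_shift del: sum.atMost_Suc)
  also have "(\<Sum>k\<le>Suc ?N. (l * coeff r k) *s ?p k) = (\<Sum>k\<le>?N. (l * coeff r k) *s ?p k)"
    by (simp add: coeff_eq_0)
  also have "(\<Sum>k\<le>?N. coeff r k *s ?p (Suc k)) - (\<Sum>k\<le>?N. (l * coeff r k) *s ?p k)
      = cpoly_apply r B (B *v v - l *s v)"
    unfolding cpoly_apply_def pow vector_ssub_ldistrib sum_subtractf vector_smult_assoc
    by (simp only: mult.commute[of l])
  finally show ?thesis .
qed

text \<open>
  Induction on the degree of \<open>q\<close>: for a root \<open>l\<close> of \<open>q\<close>, the function \<open>u = (B - l) v\<close> is a solution killed
  asymptotically by \<open>q / (X - l)\<close>, so \<open>u\<close> tends to \<open>0\<close>. Either \<open>B - l\<close> is invertible, or \<open>l\<close> is an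
  eigenvalue and \<open>v' = l v + u\<close> decays.
\<close>

lemma linear_ode_decay:
  fixes B :: "complex^'n^'n" and v :: "real \<Rightarrow> complex^'n"
  assumes ev: "\<And>z w. w \<noteq> 0 \<Longrightarrow> B *v w = z *s w \<Longrightarrow> Re z < 0"
    and "q \<noteq> 0"
    and "\<And>t. (v has_vector_derivative B *v v t) (at t)"
    and "((\<lambda>t. cpoly_apply q B (v t)) \<longlongrightarrow> 0) at_top"
  shows "(v \<longlongrightarrow> 0) at_top"
  using assms(2-)
proof (induction "degree q" arbitrary: q v)
  case 0
  then obtain c where c: "q = [:c:]" "c \<noteq> 0"
    by (metis degree_eq_zeroE pCons_0_0)
  have "((\<lambda>t. c * (v t $ i)) \<longlongrightarrow> 0) at_top" for i
    using tendsto_vec_nth[OF 0(4), of i] by (simp add: c cpoly_apply_def)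
  then have "((\<lambda>t. inverse c * (c * (v t $ i))) \<longlongrightarrow> 0) at_top" for i
    using tendsto_mult_right_zero by blast
  then show ?case
    using c(2) by (intro vec_tendstoI) (simp add: mult.assoc[symmetric])
next
  case (Suc n)
  obtain l where "poly q l = 0"
    using alg_closed_imp_poly_has_root[of q] Suc(2) by auto
  then obtain r where r: "q = [:- l, 1:] * r"
    by (auto simp: poly_eq_0_iff_dvd)
  have "r \<noteq> 0" using r Suc(3) by auto
  then have "degree q = Suc (degree r)"
    unfolding r by (subst degree_mult_eq) auto
  then have n: "n = degree r" using Suc(2) by simp
  define g where "g w = B *v w - l *s w" for w
  have lin: "linear g"
    by (rule linearI) (auto simp: g_def vec_eq_iff matrix_vector_mult_def algebra_simps sum.distrib
        scaleR_sum_right)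
  then have blin: "bounded_linear g"
    by (simp add: linear_conv_bounded_linear)
  have u: "((\<lambda>t. g (v t)) \<longlongrightarrow> 0) at_top"
  proof (rule Suc(1)[OF n \<open>r \<noteq> 0\<close>])
    show "((\<lambda>t. g (v t)) has_vector_derivative B *v g (v t)) (at t)" for t
    proof -
      have "g (B *v v t) = B *v g (v t)"
        by (simp add: g_def vec.diff vec.scale)
      then show ?thesis
        using bounded_linear.has_vector_derivative[OF blin Suc(4)[of t]] by simp
    qed
    show "((\<lambda>t. cpoly_apply r B (g (v t))) \<longlongrightarrow> 0) at_top"
      using Suc(5) by (simp only: r cpoly_apply_linear_factor g_def)
  qed
  show ?case
  proof (cases "inj g")
    case True
    then obtain h where "linear h" "h \<circ> g = id"
      using linear_injective_left_inverse[OF lin] by blast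
    then have "((\<lambda>t. h (g (v t))) \<longlongrightarrow> 0) at_top"
      using bounded_linear.tendsto_zero[OF _ u] by (simp add: linear_conv_bounded_linear)
    then show ?thesis
      using \<open>h \<circ> g = id\<close> by (simp add: fun_eq_iff)
  next
    case False
    then obtain w where "w \<noteq> 0" "g w = 0"
      using linear_injective_0[OF lin] by blast
    then have "Re l < 0"
      by (intro ev[of w]) (auto simp: g_def)
    show ?thesis
    proof (rule vec_tendstoI)
      fix i
      have "((\<lambda>t. v t $ i) has_vector_derivative l * v t $ i + g (v t) $ i) (at t)" for t
        using bounded_linear.has_vector_derivative[OF bounded_linear_vec_nth Suc(4)[of t], of i]
        by (simp add: g_def)
      then show "((\<lambda>t. v t $ i) \<longlongrightarrow> 0 $ i) at_top"
        using complex_linear_ode_decay[OF _ \<open>Re l < 0\<close>, of "\<lambda>t. v t $ i" "\<lambda>t. g (v t) $ i"]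
          tendsto_vec_nth[OF u, of i] by simp
    qed
  qed
qed

lemma trajectory_has_vector_derivative:
  "(trajectory A x has_vector_derivative A *v trajectory A x t) (at t)"
  using bounded_linear.has_vector_derivative[OF mv.bounded_linear_left
      mat_exp_has_vector_derivative[of A t], of x]
  by (simp add: trajectory_def[abs_def] matrix_vector_mul_assoc)

text \<open>After complexification by \<open>c\<close>, the minimal polynomial annihilates the
  solution identically, so the decay result for linear systems applies with \<open>q\<close> the
  complexified minimal polynomial.\<close>

lemma trajectory_tendsto_0:
  fixes A :: "real^'n^'n"
  assumes "hurwitz A"
  shows "(trajectory A x \<longlongrightarrow> 0) at_top"
proof -
  let ?B = "map_matrix complex_of_real A"
  define c :: "real^'n \<Rightarrow> complex^'n" where "c w = (\<chi> i. of_real (w $ i))" for w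
  define q where "q = map_poly complex_of_real (min_poly A)"
  have lin: "linear c"
    by (rule linearI) (auto simp: c_def vec_eq_iff complex_eq_iff)
  have mult: "c (M *v w) = map_matrix complex_of_real M *v c w" for M w
    by (simp add: c_def vec_eq_iff matrix_vector_mult_def map_matrix_def)
  have pow: "((*v) ?B ^^ k) (c w) = c (mat_power A k *v w)" for k w
    by (induction k) (auto simp: mat_power_0 mat_power_Suc mult matrix_vector_mul_assoc[symmetric])
  have sc: "(of_real r :: complex) *s c w = c (r *\<^sub>R w)" for r w
    by (simp add: c_def vec_eq_iff)
  have "cpoly_apply q ?B (c w) = c (poly_mat (min_poly A) A *v w)" for w
    by (simp add: cpoly_apply_def q_def degree_map_poly coeff_map_poly pow sc poly_mat_def
        mv.sum_left mv.scaleR_left linear_sum[OF lin])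
  then have q0: "cpoly_apply q ?B (c w) = 0" for w
    by (simp add: poly_mat_min_poly linear_0[OF lin])
  have "((\<lambda>t. c (trajectory A x t)) \<longlongrightarrow> 0) at_top"
  proof (rule linear_ode_decay)
    show "q \<noteq> 0"
      using min_poly_nonzero[of A] by (simp add: q_def map_poly_eq_0_iff)
    show "Re z < 0" if "w \<noteq> 0" "?B *v w = z *s w" for z w
      using assms that unfolding hurwitz_def complex_eigenvalue_def by blast
    show "((\<lambda>t. c (trajectory A x t)) has_vector_derivative ?B *v c (trajectory A x t)) (at t)" for t
      using bounded_linear.has_vector_derivative[OF _ trajectory_has_vector_derivative, of c A x t]
        lin by (simp add: mult linear_conv_bounded_linear)
  qed (simp add: q0)
  then have "((\<lambda>t. Re (c (trajectory A x t) $ i)) \<longlongrightarrow> 0) at_top" for i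
    using tendsto_Re[OF tendsto_vec_nth] by fastforce
  then show ?thesis
    by (intro vec_tendstoI) (simp add: c_def)
qed

section \<open>Symmetrized convex hulls and invariant subspaces\<close>

lemma sym_convex_hull_uminus:
  assumes "z \<in> sym_convex_hull X" shows "- z \<in> sym_convex_hull X"
proof -
  have "uminus ` (convex hull (X \<union> uminus ` X)) = convex hull (uminus ` (X \<union> uminus ` X))"
    by (rule convex_hull_linear_image) (simp add: linear_uminus)
  also have "uminus ` (X \<union> uminus ` X) = X \<union> uminus ` X"
    by (auto simp: image_image image_Un)
  finally show ?thesis
    using assms unfolding sym_convex_hull_def by blast
qed

lemma convex_sym_convex_hull: "convex (sym_convex_hull X)"
  by (simp add: sym_convex_hull_def)

lemma sym_convex_hull_superset: "X \<subseteq> sym_convex_hull X"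
  unfolding sym_convex_hull_def by (meson hull_subset le_sup_iff)

lemma sym_convex_hull_mono: "X \<subseteq> Y \<Longrightarrow> sym_convex_hull X \<subseteq> sym_convex_hull Y"
  unfolding sym_convex_hull_def by (intro hull_mono Un_mono image_mono)

lemma sym_convex_hull_minimal:
  assumes "X \<subseteq> sym_convex_hull Y" shows "sym_convex_hull X \<subseteq> sym_convex_hull Y"
proof -
  have "X \<union> uminus ` X \<subseteq> sym_convex_hull Y"
    using assms sym_convex_hull_uminus by blast
  then show ?thesis
    unfolding sym_convex_hull_def[of X] by (rule hull_minimal) (rule convex_sym_convex_hull)
qed

lemma rel_interior_sym_convex_hull_uminus:
  assumes "z \<in> rel_interior (sym_convex_hull X)"
  shows "- z \<in> rel_interior (sym_convex_hull X)"
proof -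
  let ?S = "sym_convex_hull X"
  have ne: "?S \<noteq> {}" using assms rel_interior_subset by blast
  note iff = convex_rel_interior_iff[OF convex_sym_convex_hull ne]
  show ?thesis
    unfolding iff
  proof
    fix w assume "w \<in> ?S"
    then obtain e where "e > 1" "(1 - e) *\<^sub>R (- w) + e *\<^sub>R z \<in> ?S"
      using assms sym_convex_hull_uminus unfolding iff by blast
    moreover have "(1 - e) *\<^sub>R w + e *\<^sub>R (- z) = - ((1 - e) *\<^sub>R (- w) + e *\<^sub>R z)"
      by simp
    ultimately show "\<exists>e>1. (1 - e) *\<^sub>R w + e *\<^sub>R (- z) \<in> ?S"
      using sym_convex_hull_uminus by metis
  qed
qed

lemma zero_in_rel_interior_sym_convex_hull:
  assumes "X \<noteq> {}" shows "0 \<in> rel_interior (sym_convex_hull X)"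
proof -
  have ne: "sym_convex_hull X \<noteq> {}" using assms sym_convex_hull_superset by blast
  show ?thesis
    unfolding convex_rel_interior_iff[OF convex_sym_convex_hull ne]
    \<comment> \<open>With factor 2, prolonging the segment from \<open>w\<close> through 0 ends at
      \<open>- w\<close>, which lies in the hull by symmetry.\<close>
    by (intro ballI exI[of _ 2]) (simp add: sym_convex_hull_uminus)
qed

text \<open>The hull contains 0, so its affine hull is linear. This identifies the relative interior
  with the interior taken in the spanned subspace.\<close>

lemma affine_hull_sym_convex_hull:
  assumes "X \<noteq> {}" shows "affine hull (sym_convex_hull X) = span X"
proof -
  have "0 \<in> sym_convex_hull X"
    using zero_in_rel_interior_sym_convex_hull[OF assms] rel_interior_subset by blast
  then have "affine hull (sym_convex_hull X) = span (sym_convex_hull X)"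
    by (intro affine_hull_span_0 hull_inc)
  also have "\<dots> = span X"
  proof
    have "X \<union> uminus ` X \<subseteq> span X"
      by (auto intro: span_base span_neg)
    then have "sym_convex_hull X \<subseteq> span X"
      unfolding sym_convex_hull_def by (rule hull_minimal) (simp add: subspace_imp_convex)
    then show "span (sym_convex_hull X) \<subseteq> span X"
      by (rule span_minimal) simp
  qed (rule span_mono[OF sym_convex_hull_superset])
  finally show ?thesis .
qed

lemma compact_sym_convex_hull:
  assumes "compact X" shows "compact (sym_convex_hull X)"
  unfolding sym_convex_hull_def
  using assms by (intro compact_convex_hull compact_Un compact_continuous_image continuous_intros)

lemma inner_le_1_on_sym_convex_hull:
  assumes "\<And>z. z \<in> X \<Longrightarrow> \<bar>y \<bullet> z\<bar> \<le> 1" "z \<in> sym_convex_hull X"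
  shows "y \<bullet> z \<le> 1"
proof -
  have "X \<union> uminus ` X \<subseteq> {z. y \<bullet> z \<le> 1}"
    using assms(1) by (fastforce simp: abs_le_iff)
  then have "sym_convex_hull X \<subseteq> {z. y \<bullet> z \<le> 1}"
    unfolding sym_convex_hull_def by (rule hull_minimal) (rule convex_halfspace_le)
  then show ?thesis using assms(2) by blast
qed

text \<open>The image of a basis spans a space of the same dimension, so no two basis vectors
  collide and the image is again independent.\<close>

lemma inj_on_if_dim_image_eq:
  fixes f :: "'a::euclidean_space \<Rightarrow> 'b::euclidean_space"
  assumes "linear f" "subspace S" "dim (f ` S) = dim S"
  shows "inj_on f S"
proof -
  obtain B where B: "B \<subseteq> S" "independent B" "S \<subseteq> span B" "card B = dim S"
    using basis_exists by blast
  have fin: "finite B" using B(2) by (rule independent_imp_finite)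
  have S: "S = span B"
    using B assms(2) by (simp add: span_minimal subset_antisym)
  have fS: "f ` S = span (f ` B)"
    unfolding S by (rule linear_span_image[OF assms(1), symmetric])
  have "card B \<le> card (f ` B)"
    using dim_le_card'[of "f ` B"] fin B(4) assms(3) fS by simp
  then have "card (f ` B) = card B"
    using card_image_le[OF fin, of f] by simp
  moreover from this have "independent (f ` B)"
    using fin B(4) assms(3) fS by (intro card_le_dim_spanning[of _ "f ` S"]) (auto simp: span_superset)
  ultimately show ?thesis
    unfolding S using assms(1) fin
    by (intro linear_inj_on_span_independent_image) (simp_all add: eq_card_imp_inj_on)
qed

text \<open>Let \<open>b\<close> be the component of \<open>f'\<close> orthogonal to
  \<open>S\<close>. The function \<open>b \<bullet> f s\<close> vanishes for
  \<open>s \<ge> t\<close>, so its right derivative \<open>b \<bullet> f'\<close>, which equals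
  \<open>b \<bullet> b\<close>, is 0.\<close>

lemma has_vector_derivative_in_subspace:
  fixes f :: "real \<Rightarrow> 'a::euclidean_space"
  assumes "subspace S" "\<And>s. s \<ge> t \<Longrightarrow> f s \<in> S" and deriv: "(f has_vector_derivative f') (at t)"
  shows "f' \<in> S"
proof -
  obtain a b where ab: "a \<in> span S" "\<And>w. w \<in> span S \<Longrightarrow> orthogonal b w" "f' = a + b"
    using orthogonal_subspace_decomp_exists[of S f'] by blast
  have span: "span S = S" using assms(1) by simp
  have "((\<lambda>s. b \<bullet> f s) has_vector_derivative b \<bullet> f') (at t within {t..})"
    by (intro bounded_linear.has_vector_derivative[OF bounded_linear_inner_right]
        has_vector_derivative_at_within[OF deriv])
  then have "((\<lambda>s. (b \<bullet> f s - b \<bullet> f t) / (s - t)) \<longlongrightarrow> b \<bullet> f') (at t within {t..})"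
    by (simp add: has_real_derivative_iff_has_vector_derivative[symmetric] has_field_derivative_iff)
  moreover have "\<forall>\<^sub>F s in at t within {t..}. (b \<bullet> f s - b \<bullet> f t) / (s - t) = 0"
    using ab(2) assms(2) by (auto simp: eventually_at_filter orthogonal_def span)
  ultimately have "((\<lambda>s. 0) \<longlongrightarrow> b \<bullet> f') (at t within {t..})"
    by (rule Lim_transform_eventually)
  moreover have "at t within {t..} \<noteq> bot"
    by (simp add: at_within_Ici_at_right)
  ultimately have "b \<bullet> f' = 0"
    using tendsto_const tendsto_unique by metis
  then have "b \<bullet> b = 0"
    using ab by (simp add: inner_add_right orthogonal_def)
  then show ?thesis using ab span by simp
qed

text \<open>The right side is an invariant subspace containing \<open>x\<close>; conversely any such
  subspace contains all \<open>mat_power A k *v x\<close> and hence their span.\<close>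

lemma invariant_subspace_hull:
  fixes A :: "real^'n^'n"
  shows "invariant_subspace A hull {x} = (\<lambda>M. M *v x) ` matrix_algebra A"
proof
  have lin: "linear (\<lambda>M :: real^'n^'n. M *v x)"
    by (rule bounded_linear.linear[OF mv.bounded_linear_left])
  have sub: "subspace ((\<lambda>M. M *v x) ` matrix_algebra A)"
    by (rule linear_subspace_image[OF lin subspace_matrix_algebra])
  moreover have "A *v (M *v x) \<in> (\<lambda>M. M *v x) ` matrix_algebra A" if "M \<in> matrix_algebra A" for M
    using mult_in_matrix_algebra[OF that] by (auto simp: matrix_vector_mul_assoc)
  moreover have "x \<in> (\<lambda>M. M *v x) ` matrix_algebra A"
    using mat_1_in_matrix_algebra by (intro image_eqI[of _ _ "mat 1"]) auto
  ultimately show "invariant_subspace A hull {x} \<subseteq> (\<lambda>M. M *v x) ` matrix_algebra A"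
    by (intro hull_minimal) (auto simp: invariant_subspace_def)
  show "(\<lambda>M. M *v x) ` matrix_algebra A \<subseteq> invariant_subspace A hull {x}"
    unfolding hull_def
  proof (intro Inter_greatest)
    fix S assume "S \<in> {t. invariant_subspace A t \<and> {x} \<subseteq> t}"
    then have S: "subspace S" "\<And>v. v \<in> S \<Longrightarrow> A *v v \<in> S" "x \<in> S"
      by (auto simp: invariant_subspace_def)
    have "mat_power A k *v x \<in> S" for k
      by (induction k) (auto simp: mat_power_0 mat_power_Suc S matrix_vector_mul_assoc[symmetric])
    moreover have "matrix_algebra A \<subseteq> {M. M *v x \<in> S}"
      if "\<And>k. mat_power A k *v x \<in> S"
      unfolding matrix_algebra_def
      by (rule span_minimal) (use that in \<open>auto intro: linear_subspace_vimage[OF lin S(1), unfolded vimage_def]\<close>)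
    ultimately show "(\<lambda>M. M *v x) ` matrix_algebra A \<subseteq> S" by blast
  qed
qed

section \<open>Cut tail points\<close>

lemma trajectory_0: "trajectory A x 0 = x"
  using mat_exp_0[of A] by (simp add: trajectory_def)

lemma trajectory_add: "trajectory A x (s + t) = mat_exp (s *\<^sub>R A) *v trajectory A x t"
  by (simp add: trajectory_def mat_exp_add matrix_vector_mul_assoc)

lemma continuous_on_trajectory: "continuous_on S (trajectory A x)"
  by (meson continuous_at_imp_continuous_on has_vector_derivative_continuous
      trajectory_has_vector_derivative)

text \<open>Injectivity of the orbit map on the algebra is what both branches in the definition of
  cut tail points have in common, so one argument serves both.\<close>

locale faithful_trajectory =
  fixes A :: "real^'n^'n" and x0 :: "real^'n"
  assumes hurwitz: "hurwitz A"
    and faithful: "M \<in> matrix_algebra A \<Longrightarrow> M *v x0 = 0 \<Longrightarrow> M = 0"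
begin

abbreviation "x \<equiv> trajectory A x0"
abbreviation "W \<equiv> matrix_algebra A"

definition "L = (\<lambda>M. M *v x0) ` W"
definition "G = sym_convex_hull (x ` {0..})"
text \<open>The polar is taken in the whole space: it contains the orthogonal complement of
  \<open>L\<close>, so it is unbounded whenever \<open>L\<close> is proper.\<close>

definition "polar = {y. \<forall>t\<ge>0. \<bar>y \<bullet> x t\<bar> \<le> 1}"

lemma linear_orbit: "linear (\<lambda>M :: real^'n^'n. M *v x0)"
  by (rule bounded_linear.linear[OF mv.bounded_linear_left])

lemma inj_orbit: "inj_on (\<lambda>M. M *v x0) W"
proof (rule inj_onI)
  fix M N assume MN: "M \<in> W" "N \<in> W" "M *v x0 = N *v x0"
  then have "M - N = 0"
    by (intro faithful subspace_diff[OF subspace_matrix_algebra]) (simp_all add: mv.diff_left)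
  then show "M = N" by simp
qed

lemma subspace_L: "subspace L"
  unfolding L_def by (rule linear_subspace_image[OF linear_orbit subspace_matrix_algebra])

lemma trajectory_in_L: "x t \<in> L"
  unfolding L_def trajectory_def using mat_exp_in_matrix_algebra by blast

lemma x0_nonzero: "x0 \<noteq> 0"
proof
  assume "x0 = 0"
  then have "(mat 1 :: real^'n^'n) = 0"
    using faithful[OF mat_1_in_matrix_algebra] by simp
  then have "(mat 1 :: real^'n^'n) $ i $ i = 0" for i
    by simp
  then show False
    by (simp add: mat_def)
qed

text \<open>The span contains the derivatives \<open>A *v x t\<close>, hence is invariant; it
  contains \<open>x0\<close>, so it includes the smallest invariant subspace around
  \<open>x0\<close>.\<close>

lemma span_trajectory: "span (x ` {0..}) = L"
proof
  show "span (x ` {0..}) \<subseteq> L"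
    by (rule span_minimal) (auto simp: trajectory_in_L subspace_L)
  let ?S = "span (x ` {0..})"
  have Ax: "A *v x t \<in> ?S" if "t \<ge> 0" for t
    by (rule has_vector_derivative_in_subspace[OF _ _ trajectory_has_vector_derivative])
      (use that in \<open>auto intro: span_base\<close>)
  have AS: "A *v v \<in> ?S" if "v \<in> ?S" for v
    using that
  proof (induction rule: span_induct_alt)
    case (step c v w)
    then show ?case
      using Ax by (auto simp: mv.add_right mv.scaleR_right intro: span_add span_scale)
  qed (simp add: span_zero)
  have "invariant_subspace A ?S"
    by (simp add: invariant_subspace_def AS)
  moreover have "x0 \<in> ?S"
    by (rule span_base) (force intro: image_eqI[of _ _ 0] simp: trajectory_0)
  ultimately have "invariant_subspace A hull {x0} \<subseteq> ?S"
    by (intro hull_minimal) auto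
  then show "L \<subseteq> ?S"
    unfolding L_def invariant_subspace_hull .
qed

text \<open>A basis of \<open>L\<close> chosen among trajectory points uses finitely many times;
  \<open>s\<close> is their maximum.\<close>

lemma span_initial_segment: "\<exists>s\<ge>0. span (x ` {0..s}) = L"
proof -
  obtain B where B: "B \<subseteq> x ` {0..}" "independent B" "x ` {0..} \<subseteq> span B"
    using maximal_independent_subset by blast
  then obtain C where C: "C \<subseteq> {0..}" "finite C" "B = x ` C"
    using finite_subset_image independent_imp_finite by metis
  define s where "s = Max (insert 0 C)"
  have s: "s \<ge> 0" "C \<subseteq> {0..s}"
    using C(1,2) unfolding s_def by (auto intro: Max_ge)
  have "L \<subseteq> span (x ` {0..s})"
    unfolding span_trajectory[symmetric]
  proof (rule span_minimal)
    have "span B \<subseteq> span (x ` {0..s})"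
      using s(2) C(3) by (intro span_mono) auto
    then show "x ` {0..} \<subseteq> span (x ` {0..s})" using B(3) by blast
  qed simp
  moreover have "span (x ` {0..s}) \<subseteq> L"
    by (rule span_minimal) (auto simp: trajectory_in_L subspace_L)
  ultimately show ?thesis using s(1) by blast
qed

text \<open>The hull of a spanning initial arc already contains a ball of \<open>L\<close> around 0,
  and the decaying tail ends up in that ball. Thus \<open>G\<close> is the hull of a compact arc,
  which makes it compact.\<close>

lemma G_eq_traj_hull: "\<exists>N\<ge>0. G = traj_hull A x0 0 N"
proof -
  obtain s where s: "s \<ge> 0" "span (x ` {0..s}) = L"
    using span_initial_segment by blast
  have ne: "x ` {0..s} \<noteq> {}" using s(1) by auto
  obtain e where e: "e > 0" "ball 0 e \<inter> L \<subseteq> traj_hull A x0 0 s"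
    using zero_in_rel_interior_sym_convex_hull[OF ne] affine_hull_sym_convex_hull[OF ne] s(2)
    unfolding mem_rel_interior_ball traj_hull_def by metis
  have "\<forall>\<^sub>F t in at_top. dist (x t) 0 < e"
    using tendstoD[OF trajectory_tendsto_0[OF hurwitz] e(1)] .
  then obtain N where N: "\<And>t. t \<ge> N \<Longrightarrow> dist (x t) 0 < e"
    unfolding eventually_at_top_linorder by blast
  let ?N = "max N s"
  have sub: "traj_hull A x0 0 s \<subseteq> traj_hull A x0 0 ?N"
    unfolding traj_hull_def by (intro sym_convex_hull_mono image_mono) auto
  have "x t \<in> traj_hull A x0 0 ?N" if "t \<ge> 0" for t
  proof (cases "t \<le> ?N")
    case True
    then show ?thesis
      using that sym_convex_hull_superset[of "x ` {0..?N}"] by (auto simp: traj_hull_def)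
  next
    case False
    then have "x t \<in> ball 0 e \<inter> L"
      using N[of t] trajectory_in_L by (simp add: dist_commute)
    then show ?thesis using e(2) sub by blast
  qed
  then have "G \<subseteq> traj_hull A x0 0 ?N"
    unfolding G_def traj_hull_def by (intro sym_convex_hull_minimal) auto
  moreover have "traj_hull A x0 0 ?N \<subseteq> G"
    unfolding G_def traj_hull_def by (intro sym_convex_hull_mono image_mono) auto
  ultimately show ?thesis using s(1) by (intro exI[of _ ?N]) auto
qed

lemma convex_G: "convex G"
  unfolding G_def by (rule convex_sym_convex_hull)

lemma compact_G: "compact G"
proof -
  obtain N where "G = sym_convex_hull (x ` {0..N})"
    using G_eq_traj_hull unfolding traj_hull_def by blast
  then show ?thesis
    by (simp add: compact_sym_convex_hull compact_continuous_image continuous_on_trajectory)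
qed

lemma trajectory_in_G: "t \<ge> 0 \<Longrightarrow> x t \<in> G"
  unfolding G_def by (rule subsetD[OF sym_convex_hull_superset]) simp

lemma uminus_in_G: "z \<in> G \<Longrightarrow> - z \<in> G"
  unfolding G_def by (rule sym_convex_hull_uminus)

lemma affine_hull_G: "affine hull G = L"
  unfolding G_def using affine_hull_sym_convex_hull[of "x ` {0..}"] span_trajectory by simp

lemma zero_in_rel_interior_G: "0 \<in> rel_interior G"
  unfolding G_def by (rule zero_in_rel_interior_sym_convex_hull) auto

lemma rel_interior_G: "rel_interior G = top_of_set L interior_of G"
  unfolding rel_interior_def interior_of_def affine_hull_G ..

lemma inner_le_1_on_G:
  assumes "y \<in> polar" "z \<in> G" shows "y \<bullet> z \<le> 1"
  using assms(2) unfolding G_def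
  by (rule inner_le_1_on_sym_convex_hull[rotated]) (use assms(1) in \<open>auto simp: polar_def\<close>)

text \<open>An interior point can be stretched by a factor above 1 within \<open>G\<close>, so no
  functional of the polar reaches 1 on it. At a boundary point, a supporting functional
  \<open>a\<close> has a negative value \<open>?c\<close>, and by symmetry \<open>a\<close> divided
  by \<open>?c\<close> lies in the polar and takes the value 1 there.\<close>

lemma rel_interior_G_iff:
  assumes "t \<ge> 0"
  shows "x t \<in> rel_interior G \<longleftrightarrow> (\<forall>y\<in>polar. y \<bullet> x t < 1)"
proof
  assume ri: "x t \<in> rel_interior G"
  show "\<forall>y\<in>polar. y \<bullet> x t < 1"
  proof
    fix y assume y: "y \<in> polar"
    have "0 \<in> G" using zero_in_rel_interior_G rel_interior_subset by blast
    then obtain e where e: "e > 1" "e *\<^sub>R x t \<in> G"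
      using ri convex_rel_interior_iff[OF convex_G, of "x t"] by fastforce
    then have "e * (y \<bullet> x t) \<le> 1"
      using inner_le_1_on_G[OF y e(2)] by simp
    then show "y \<bullet> x t < 1"
      using e(1) mult_left_mono[of 1 "y \<bullet> x t" e] by linarith
  qed
next
  assume lt: "\<forall>y\<in>polar. y \<bullet> x t < 1"
  show "x t \<in> rel_interior G"
  proof (rule ccontr)
    assume "x t \<notin> rel_interior G"
    then obtain a where a: "a \<noteq> 0" "\<And>z. z \<in> G \<Longrightarrow> a \<bullet> x t \<le> a \<bullet> z"
      "\<And>z. z \<in> rel_interior G \<Longrightarrow> a \<bullet> x t < a \<bullet> z"
      by (rule supporting_hyperplane_rel_boundary[OF convex_G trajectory_in_G[OF assms]]) blast
    let ?c = "a \<bullet> x t"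
    have c: "?c < 0" using a(3)[OF zero_in_rel_interior_G] by simp
    have "\<bar>a \<bullet> z\<bar> \<le> - ?c" if "z \<in> G" for z
      using a(2)[OF that] a(2)[OF uminus_in_G[OF that]] by simp
    then have "\<bar>(1 / ?c) *\<^sub>R a \<bullet> z\<bar> \<le> 1" if "z \<in> G" for z
      using that c by (simp add: abs_mult divide_simps abs_of_neg)
    then have "(1 / ?c) *\<^sub>R a \<in> polar"
      using trajectory_in_G by (auto simp: polar_def)
    then have "((1 / ?c) *\<^sub>R a) \<bullet> x t < 1" using lt by blast
    then show False using c by simp
  qed
qed

lemma rel_interior_G_mono:
  assumes "x t \<in> rel_interior G" "0 \<le> t" "t \<le> s"
  shows "x s \<in> rel_interior G"
proof -
  define h where "h = s - t"
  have h: "h \<ge> 0" "s = h + t" using assms by (auto simp: h_def)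
  have "y \<bullet> x s < 1" if "y \<in> polar" for y
  proof -
    \<comment> \<open>Moving the semigroup onto \<open>y\<close> turns a time shift into a new
      functional; it stays in the polar because the shift \<open>h\<close> is nonnegative.\<close>
    let ?z = "y v* mat_exp (h *\<^sub>R A)"
    have shift: "?z \<bullet> x r = y \<bullet> x (h + r)" for r
      by (simp add: trajectory_add dot_lmul_matrix)
    have "?z \<in> polar"
      using that h(1) by (auto simp: polar_def shift)
    then have "?z \<bullet> x t < 1"
      using assms(1) rel_interior_G_iff[OF assms(2)] by blast
    then show ?thesis by (simp add: shift h(2))
  qed
  then show ?thesis
    using rel_interior_G_iff[of s] assms by simp
qed

text \<open>Extreme points of a hull lie in the generating set. They avoid the relative interior
  because \<open>G\<close> is not a single point: it contains \<open>x0\<close> and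
  \<open>- x0\<close>, which differ.\<close>

lemma extreme_point_of_G:
  assumes "e extreme_point_of G"
  shows "\<exists>t\<ge>0. x t \<notin> rel_interior G \<and> (e = x t \<or> e = - x t)"
proof -
  have "e \<in> x ` {0..} \<union> uminus ` x ` {0..}"
    using assms extreme_point_of_convex_hull unfolding G_def sym_convex_hull_def by blast
  then obtain t where t: "t \<ge> 0" "e = x t \<or> e = - x t" by auto
  have "x0 \<in> G" "- x0 \<in> G"
    using trajectory_in_G[of 0] uminus_in_G[of x0] by (simp_all add: trajectory_0)
  then have "G \<noteq> {e}"
    using x0_nonzero by (metis eq_neg_iff_add_eq_0 singletonD scaleR_2 scaleR_eq_0_iff zero_neq_numeral)
  then have "e \<notin> rel_interior G"
    using extreme_point_not_in_REL_INTERIOR[OF assms] by blast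
  then have "x t \<notin> rel_interior G"
    using t(2) rel_interior_sym_convex_hull_uminus unfolding G_def by blast
  then show ?thesis using t by blast
qed

lemma G_eq_hull_boundary:
  "G = sym_convex_hull (x ` {t. t \<ge> 0 \<and> x t \<notin> rel_interior G})"
proof
  let ?X = "x ` {t. t \<ge> 0 \<and> x t \<notin> rel_interior G}"
  have "{e. e extreme_point_of G} \<subseteq> ?X \<union> uminus ` ?X"
    using extreme_point_of_G by blast
  then show "G \<subseteq> sym_convex_hull ?X"
    unfolding sym_convex_hull_def
    by (subst Krein_Milman_Minkowski[OF compact_G convex_G]) (rule hull_mono)
  show "sym_convex_hull ?X \<subseteq> G"
    unfolding G_def by (rule sym_convex_hull_mono) auto
qed

text \<open>Otherwise monotonicity would leave no boundary times at all, and \<open>G\<close> would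
  be the hull of the empty set.\<close>

lemma x0_notin_rel_interior_G: "x 0 \<notin> rel_interior G"
proof
  assume "x 0 \<in> rel_interior G"
  then have empty: "{t. t \<ge> 0 \<and> x t \<notin> rel_interior G} = {}"
    using rel_interior_G_mono[of 0] by auto
  have "G = {}"
    using G_eq_hull_boundary unfolding empty by (simp add: sym_convex_hull_def)
  then show False
    using trajectory_in_G[of 0] by simp
qed

text \<open>The set \<open>U\<close> of interior times is upward closed, nonempty by decay, open by
  continuity, and omits 0; so it is an open ray starting at its infimum.\<close>

lemma rel_interior_G_threshold:
  obtains T0 where "T0 \<ge> 0" "\<And>t. t \<ge> 0 \<Longrightarrow> x t \<in> rel_interior G \<longleftrightarrow> T0 < t"
proof -
  define U where "U = {t. t \<ge> 0 \<and> x t \<in> rel_interior G}"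
  obtain R where R: "open R" "rel_interior G = L \<inter> R"
    using openin_rel_interior[of G] unfolding affine_hull_G openin_open by blast
  have U: "t \<in> U \<longleftrightarrow> t \<ge> 0 \<and> x t \<in> R" for t
    by (auto simp: U_def R(2) trajectory_in_L)
  have "\<forall>\<^sub>F t in at_top. x t \<in> R"
    using topological_tendstoD[OF trajectory_tendsto_0[OF hurwitz] R(1)] zero_in_rel_interior_G R(2)
    by auto
  then obtain N where N: "\<And>t. t \<ge> N \<Longrightarrow> x t \<in> R"
    unfolding eventually_at_top_linorder by blast
  have ne: "U \<noteq> {}" using N[of "max N 0"] U[of "max N 0"] by auto
  have bdd: "bdd_below U" by (rule bdd_belowI[of _ 0]) (simp add: U_def)
  define T0 where "T0 = Inf U"
  have "T0 \<ge> 0"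
    unfolding T0_def by (rule cInf_greatest[OF ne]) (simp add: U_def)
  moreover have "x t \<in> rel_interior G \<longleftrightarrow> T0 < t" if t: "t \<ge> 0" for t
  proof
    assume "T0 < t"
    then obtain u where "u \<in> U" "u < t"
      using cInf_lessD[OF ne] unfolding T0_def by blast
    then show "x t \<in> rel_interior G"
      using rel_interior_G_mono[of u t] by (simp add: U_def)
  next
    assume ri: "x t \<in> rel_interior G"
    then have "t > 0"
      using x0_notin_rel_interior_G t by (cases "t = 0") auto
    have "open (x -` R)"
      using continuous_on_trajectory R(1) by (metis continuous_on_open_vimage Int_UNIV_right open_UNIV)
    moreover have "t \<in> x -` R" using ri R(2) by blast
    ultimately obtain e where e: "e > 0" "ball t e \<subseteq> x -` R"
      using open_contains_ball by blast
    \<comment> \<open>Stepping back by \<open>d\<close> stays within the neighbourhood and at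
      nonnegative times, so \<open>t\<close> lies strictly above the infimum.\<close>
    define d where "d = min (e / 2) (t / 2)"
    have "d > 0" "t - d \<ge> 0" "t - d \<in> ball t e"
      using e(1) \<open>t > 0\<close> by (auto simp: d_def dist_real_def)
    then have "t - d \<in> U" using e(2) U by blast
    then have "T0 \<le> t - d"
      unfolding T0_def by (rule cInf_lower[OF _ bdd])
    then show "T0 < t" using \<open>d > 0\<close> by simp
  qed
  ultimately show ?thesis by (rule that)
qed

section \<open>Quasipolynomials and the extremal problem\<close>

lemma quasipoly_space_eq: "quasipoly_space A = range (\<lambda>y t. y \<bullet> x t)"
proof (intro subset_antisym subsetI)
  fix p assume "p \<in> quasipoly_space A"
  then obtain c where c: "\<And>t. p t = c \<bullet> mat_exp (t *\<^sub>R A)"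
    by (auto simp: quasipoly_space_def inner_vec_def)
  \<comment> \<open>The left inverse \<open>g\<close> of the orbit map recovers the exponential from
    \<open>x t\<close>; its adjoint converts the coefficient matrix \<open>c\<close> into the vector
    representing \<open>p\<close>.\<close>
  obtain g where g: "linear g" "\<And>M. M \<in> W \<Longrightarrow> g (M *v x0) = M"
    using linear_exists_left_inverse_on[OF linear_orbit subspace_matrix_algebra inj_orbit] by blast
  have "p t = adjoint g c \<bullet> x t" for t
    using g(2)[OF mat_exp_in_matrix_algebra, of t]
    by (simp add: c trajectory_def inner_commute[of "adjoint g c"] adjoint_works[OF g(1)]
        inner_commute[of c])
  then show "p \<in> range (\<lambda>y t. y \<bullet> x t)" by blast
next
  fix p assume "p \<in> range (\<lambda>y t. y \<bullet> x t)"
  then obtain y where y: "p = (\<lambda>t. y \<bullet> x t)" by blast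
  show "p \<in> quasipoly_space A"
    unfolding quasipoly_space_def y
    \<comment> \<open>The coefficient matrix is the rank-one matrix formed from \<open>y\<close> and
      \<open>x0\<close>.\<close>
    by (intro CollectI exI[of _ "\<chi> i j. y $ i * x0 $ j"])
      (simp add: trajectory_def inner_vec_def matrix_vector_mult_def sum_distrib_left mult_ac)
qed

lemma half_line_norm_le_1_iff: "half_line_norm p \<le> 1 \<longleftrightarrow> (\<forall>t\<ge>0. \<bar>p t\<bar> \<le> 1)"
  unfolding half_line_norm_def by (auto simp: SUP_le_iff one_ereal_def)

text \<open>For boundedness, a nonzero \<open>y\<close> in \<open>L\<close> is tested against its
  own multiple of norm \<open>e / 2\<close>, which lies in the ball contained in
  \<open>G\<close>.\<close>

lemma compact_polar: "compact (polar \<inter> L)"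
proof -
  obtain e where e: "e > 0" "ball 0 e \<inter> L \<subseteq> G"
    using zero_in_rel_interior_G affine_hull_G unfolding mem_rel_interior_ball by metis
  have "norm y \<le> 2 / e" if "y \<in> polar" "y \<in> L" for y
  proof (cases "y = 0")
    case False
    let ?z = "(e / 2 / norm y) *\<^sub>R y"
    have "?z \<in> ball 0 e \<inter> L"
      using e(1) False that(2) subspace_scale[OF subspace_L] by simp
    then have "y \<bullet> ?z \<le> 1"
      using e(2) inner_le_1_on_G[OF that(1)] by blast
    also have "y \<bullet> ?z = e / 2 * norm y"
      using False by (simp add: dot_square_norm power2_eq_square)
    finally show ?thesis using e(1) by (simp add: field_simps)
  qed (use e(1) in simp)
  then have "bounded (polar \<inter> L)"
    by (auto simp: bounded_iff)
  moreover have "polar = (\<Inter>t\<in>{0..}. {y. \<bar>y \<bullet> x t\<bar> \<le> 1})"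
    by (auto simp: polar_def)
  then have "closed polar"
    by (simp add: closed_INT closed_Collect_le continuous_on_rabs continuous_on_inner)
  ultimately show ?thesis
    using closed_subspace[OF subspace_L] by (simp add: compact_eq_bounded_closed closed_Int)
qed

lemma extremal_value_less_1_iff:
  assumes "T \<ge> 0"
  shows "extremal_value A T < 1 \<longleftrightarrow> x T \<in> rel_interior G"
proof -
  have "0 \<in> polar \<inter> L"
    using subspace_0[OF subspace_L] by (simp add: polar_def)
  then have "polar \<inter> L \<noteq> {}"
    by (metis empty_iff)
  moreover have "continuous_on (polar \<inter> L) (\<lambda>z. z \<bullet> x T)"
    by (intro continuous_intros)
  ultimately obtain y where "y \<in> polar \<inter> L" "\<forall>z\<in>polar \<inter> L. z \<bullet> x T \<le> y \<bullet> x T"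
    using continuous_attains_sup[OF compact_polar] by blast
  then have y: "y \<in> polar" "\<And>z. z \<in> polar \<Longrightarrow> z \<in> L \<Longrightarrow> z \<bullet> x T \<le> y \<bullet> x T"
    by auto
  \<comment> \<open>The component orthogonal to \<open>L\<close> is invisible to the trajectory, so
    the maximum over the compact slice is the maximum over the entire polar. Being attained, it is
    below 1 exactly when all values are.\<close>
  have max: "z \<bullet> x T \<le> y \<bullet> x T" if z: "z \<in> polar" for z
  proof -
    obtain a b where ab: "a \<in> L" "\<And>w. w \<in> L \<Longrightarrow> orthogonal b w" "z = a + b"
      using orthogonal_subspace_decomp_exists[of L z] unfolding span_eq_iff[THEN iffD2, OF subspace_L]
      by blast
    have eq: "z \<bullet> x t = a \<bullet> x t" for t
      using ab(2)[OF trajectory_in_L[of t]] ab(3) by (simp add: inner_add_left orthogonal_def)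
    then have "a \<in> polar" using z by (simp add: polar_def)
    then show ?thesis using y(2) ab(1) eq by simp
  qed
  have "(\<exists>p\<in>quasipoly_space A. half_line_norm p \<le> 1 \<and> v = p T) \<longleftrightarrow> (\<exists>z\<in>polar. v = z \<bullet> x T)" for v
    by (auto simp: quasipoly_space_eq half_line_norm_le_1_iff polar_def)
  then have "extremal_value A T = (GREATEST v. \<exists>z\<in>polar. v = z \<bullet> x T)"
    unfolding extremal_value_def by simp
  also have "\<dots> = y \<bullet> x T"
    by (rule Greatest_equality) (use y(1) max in auto)
  finally show ?thesis
    unfolding rel_interior_G_iff[OF assms] using y(1) max by (auto intro: le_less_trans)
qed

text \<open>All boundary times lie in \<open>[0, T0]\<close>, so the hull up to \<open>T0\<close> is
  already \<open>G\<close>. Any other hull is contained in \<open>G\<close>, so a cut at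
  \<open>S\<close> makes all later times interior and hence larger than \<open>T0\<close>. The last
  property characterizes \<open>T0\<close> without reference to \<open>x0\<close>.\<close>

lemma cut_threshold:
  obtains T0 where "T0 \<ge> 0"
    "\<And>t. t > T0 \<Longrightarrow> x t \<in> top_of_set L interior_of traj_hull A x0 0 T0"
    "\<And>S. S \<ge> 0 \<Longrightarrow> (\<And>t. t > S \<Longrightarrow> x t \<in> top_of_set L interior_of traj_hull A x0 0 S) \<Longrightarrow> T0 \<le> S"
    "\<And>T. T \<ge> 0 \<Longrightarrow> T0 < T \<longleftrightarrow> extremal_value A T < 1"
proof -
  obtain T0 where T0: "T0 \<ge> 0" "\<And>t. t \<ge> 0 \<Longrightarrow> x t \<in> rel_interior G \<longleftrightarrow> T0 < t"
    using rel_interior_G_threshold by metis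
  have "{t. t \<ge> 0 \<and> x t \<notin> rel_interior G} = {0..T0}"
    using T0 by auto
  then have G: "traj_hull A x0 0 T0 = G"
    using G_eq_hull_boundary by (simp add: traj_hull_def)
  show ?thesis
  proof
    show "x t \<in> top_of_set L interior_of traj_hull A x0 0 T0" if "t > T0" for t
      using that T0 by (simp add: G rel_interior_G[symmetric])
    show "T0 \<le> S" if "S \<ge> 0" and S: "\<And>t. t > S \<Longrightarrow> x t \<in> top_of_set L interior_of traj_hull A x0 0 S" for S
    proof (rule dense_ge)
      fix t assume "S < t"
      have "traj_hull A x0 0 S \<subseteq> G"
        unfolding G_def traj_hull_def by (intro sym_convex_hull_mono image_mono) auto
      then have "x t \<in> rel_interior G"
        using S[OF \<open>S < t\<close>] interior_of_mono unfolding rel_interior_G by blast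
      then show "T0 \<le> t" using T0(2)[of t] \<open>S < t\<close> \<open>S \<ge> 0\<close> by simp
    qed
    show "T0 < T \<longleftrightarrow> extremal_value A T < 1" if "T \<ge> 0" for T
      using extremal_value_less_1_iff[OF that] T0(2)[OF that] by simp
  qed (rule T0(1))
qed

end

section \<open>Admissible initial points\<close>

lemma generic_point_iff: "generic_point A x \<longleftrightarrow> invariant_subspace A hull {x} = UNIV"
proof
  have inv: "invariant_subspace A (invariant_subspace A hull {x})"
  proof (rule hull_in)
    fix \<S> assume "Ball \<S> (invariant_subspace A)"
    then show "invariant_subspace A (\<Inter>\<S>)"
      by (auto simp: invariant_subspace_def intro: subspace_Inter)
  qed
  have "x \<in> invariant_subspace A hull {x}" by (simp add: hull_inc)
  then show "generic_point A x \<Longrightarrow> invariant_subspace A hull {x} = UNIV"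
    using inv unfolding generic_point_def by blast
  show "generic_point A x" if "invariant_subspace A hull {x} = UNIV"
    unfolding generic_point_def
  proof (intro allI impI notI)
    fix S assume "invariant_subspace A S \<and> S \<noteq> UNIV" "x \<in> S"
    then show False
      using hull_minimal[of "{x}" S "invariant_subspace A"] that by auto
  qed
qed

text \<open>The kernel of a matrix commuting with \<open>A\<close> is invariant, so a kernel
  containing a generic point is the whole space.\<close>

lemma generic_point_faithful:
  assumes "generic_point A x" "M \<in> matrix_algebra A" "M *v x = 0"
  shows "M = 0"
proof -
  have "invariant_subspace A {v. M *v v = 0}"
    using matrix_algebra_commute[OF assms(2)]
    by (auto simp: invariant_subspace_def subspace_def mv.add_right mv.scaleR_right
        matrix_vector_mul_assoc) (metis matrix_vector_mul_assoc mv.zero_right)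
  then have "{v. M *v v = 0} = UNIV"
    using assms(1,3) unfolding generic_point_def by blast
  then show ?thesis
    by (metis (mono_tags) UNIV_I mem_Collect_eq matrix_eq mv.zero_left)
qed

text \<open>The hull is the image of the algebra under the orbit map, and the algebra has dimension
  \<open>degree (min_poly A)\<close>; equality of dimensions means injectivity.\<close>

lemma dim_eq_degree_min_poly_iff:
  "dim (invariant_subspace A hull {x}) = degree (min_poly A) \<longleftrightarrow>
    (\<forall>M\<in>matrix_algebra A. M *v x = 0 \<longrightarrow> M = 0)"
proof -
  have lin: "linear (\<lambda>M :: real^'a^'a. M *v x)"
    by (rule bounded_linear.linear[OF mv.bounded_linear_left])
  have "dim ((\<lambda>M. M *v x) ` matrix_algebra A) = dim (matrix_algebra A)
      \<longleftrightarrow> inj_on (\<lambda>M. M *v x) (matrix_algebra A)"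
    using inj_on_if_dim_image_eq[OF lin subspace_matrix_algebra]
      dim_image_eq[OF lin, of "matrix_algebra A"] subspace_matrix_algebra
    by (metis span_eq_iff)
  also have "\<dots> \<longleftrightarrow> (\<forall>M\<in>matrix_algebra A. M *v x = 0 \<longrightarrow> M = 0)"
    by (rule linear_injective_on_subspace_0[OF lin subspace_matrix_algebra])
  finally show ?thesis
    by (simp add: invariant_subspace_hull degree_min_poly)
qed

theorem theorem2:
  fixes A :: "real^'n^'n" and T :: real
  assumes "hurwitz A"
    and "T > 0"
  shows "T > T_cut A \<longleftrightarrow> extremal_value A T < 1"
proof -
  define admissible where "admissible x \<longleftrightarrow>
    (if \<exists>x. generic_point A x then generic_point A x
     else dim (invariant_subspace A hull {x}) = degree (min_poly A))" for x
  have faithful: "faithful_trajectory A x" if "admissible x" for x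
    using that assms(1) generic_point_faithful dim_eq_degree_min_poly_iff
    unfolding admissible_def faithful_trajectory_def by (metis (no_types, lifting))
  \<comment> \<open>Interiors are uniformly taken in the cyclic subspace; for a generic point this
    is the whole space, giving the ordinary interior.\<close>
  define cut where "cut x S \<longleftrightarrow> 0 \<le> S \<and> (\<forall>t>S. trajectory A x t \<in>
    top_of_set (invariant_subspace A hull {x}) interior_of traj_hull A x 0 S)" for x S
  have cut_tail: "cut_tail_point A S \<longleftrightarrow> (\<exists>x. admissible x \<and> cut x S)" for S
    by (auto simp: cut_tail_point_def admissible_def cut_def generic_point_iff interior_of_topspace
        euclidean_interior_of)
  have threshold: "\<exists>T0\<ge>0. cut x T0 \<and> (\<forall>S. cut x S \<longrightarrow> T0 \<le> S) \<and>
      (\<forall>T\<ge>0. T0 < T \<longleftrightarrow> extremal_value A T < 1)" if "admissible x" for x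
  proof -
    interpret faithful_trajectory A x by (rule faithful[OF that])
    have L: "invariant_subspace A hull {x} = L"
      by (simp add: invariant_subspace_hull L_def)
    obtain T0 where T0: "T0 \<ge> 0"
      "\<And>t. t > T0 \<Longrightarrow> trajectory A x t \<in> top_of_set L interior_of traj_hull A x 0 T0"
      "\<And>S. S \<ge> 0 \<Longrightarrow> (\<And>t. t > S \<Longrightarrow> trajectory A x t \<in> top_of_set L interior_of traj_hull A x 0 S) \<Longrightarrow> T0 \<le> S"
      "\<And>T. T \<ge> 0 \<Longrightarrow> T0 < T \<longleftrightarrow> extremal_value A T < 1"
      using cut_threshold by metis
    then show ?thesis
      by (intro exI[of _ T0]) (simp add: cut_def L)
  qed
  obtain x where x: "admissible x"
    using ex_faithful_vector[of A] dim_eq_degree_min_poly_iff unfolding admissible_def by metis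
  obtain T0 where T0: "T0 \<ge> 0" "cut x T0" "\<forall>T\<ge>0. T0 < T \<longleftrightarrow> extremal_value A T < 1"
    using threshold[OF x] by blast
  have "T_cut A = T0"
    unfolding T_cut_def
  proof (rule Least_equality)
    show "cut_tail_point A T0" using cut_tail x T0(2) by blast
  next
    fix S assume "cut_tail_point A S"
    then obtain x' where x': "admissible x'" "cut x' S" using cut_tail by blast
    then obtain T1 where T1: "T1 \<ge> 0" "T1 \<le> S" "\<forall>T\<ge>0. T1 < T \<longleftrightarrow> extremal_value A T < 1"
      using threshold by blast
    \<comment> \<open>If \<open>T1 < T0\<close>, the criterion for \<open>T1\<close> at time
      \<open>T0\<close> gives an extremal value below 1, and the criterion for \<open>T0\<close>
      then yields \<open>T0 < T0\<close>.\<close>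
    then have "\<not> T1 < T0"
      using T0(1,3) by (meson order.irrefl)
    then show "T0 \<le> S" using T1(2) by simp
  qed
  then show ?thesis using T0(3) assms(2) by simp
qed

end
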